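(* Let $n\geq 5$, let $S_n$ and $A_n$ be the symmetric and alternating groups of degree $n$, and let $C\subseteq S_n$ be the set of all elements of $S_n$ whose order is a power of $2$ (including the identity). Then the verbal images of $S_n$ are exactly the subsets $X\subseteq S_n$ of one of the following two forms: (i) $X$ is an $\mathrm{Aut}(S_n)$-invariant subset of $A_n$ containing the identity; or (ii) $X=B\cup C$, where $B$ is an $\mathrm{Aut}(S_n)$-invariant subset of $S_n$.
   Context: For a word $w$ in the free group of finite rank $k$ and a group $G$, the word map $w:G^k\to G$ sends $(g_1,\dots,g_k)$ to the element obtained by substituting $g_i$ for the $i$-th free generator, and $w(G):=\{w(g_1,\dots,g_k): g_i\in G\}$. A verbal image of $G$ is a subset of $G$ of the form $w(G)$ for some word $w$ in a free group of some finite rank. A subset $X\subseteq G$ is $\mathrm{Aut}(G)$-invariant if $\alpha(X)=X$ for every $\alpha\in\mathrm{Aut}(G)$. *)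

theory Defs
  imports "HOL-Algebra.Sym_Groups" "HOL-Algebra.Multiplicative_Group" "HOL-Algebra.Bij"
begin

(* The elements of the free group on x_0, ..., x_{k-1}, as freely reduced words.
   The letter (i, True) is x_i and (i, False) is its inverse. *)
definition free_group_words :: "nat \<Rightarrow> (nat \<times> bool) list set" where
  "free_group_words k =
     {w. (\<forall>(i, b) \<in> set w. i < k) \<and> successively (\<lambda>(i, b) (j, c). i = j \<longrightarrow> b = c) w}"

definition word_map :: "('a, 'b) monoid_scheme \<Rightarrow> (nat \<times> bool) list \<Rightarrow> (nat \<Rightarrow> 'a) \<Rightarrow> 'a" where
  "word_map G w g =
     foldr (\<lambda>(i, b) x. (if b then g i else inv\<^bsub>G\<^esub> (g i)) \<otimes>\<^bsub>G\<^esub> x) w \<one>\<^bsub>G\<^esub>"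

definition word_image :: "('a, 'b) monoid_scheme \<Rightarrow> nat \<Rightarrow> (nat \<times> bool) list \<Rightarrow> 'a set" where
  "word_image G k w = word_map G w ` ({..<k} \<rightarrow>\<^sub>E carrier G)"

definition verbal_image :: "('a, 'b) monoid_scheme \<Rightarrow> 'a set \<Rightarrow> bool" where
  "verbal_image G X \<longleftrightarrow> (\<exists>k. \<exists>w \<in> free_group_words k. X = word_image G k w)"

definition aut_invariant :: "('a, 'b) monoid_scheme \<Rightarrow> 'a set \<Rightarrow> bool" where
  "aut_invariant G X \<longleftrightarrow> X \<subseteq> carrier G \<and> (\<forall>\<alpha> \<in> auto G. \<alpha> ` X = X)"

definition two_power_order_elements :: "('a, 'b) monoid_scheme \<Rightarrow> 'a set" where
  "two_power_order_elements G = {g \<in> carrier G. \<exists>m::nat. group.ord G g = 2 ^ m}"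

end

theory Submission
  imports Defs "HOL-Computational_Algebra.Primes"
begin

text \<open>Write $G$ for the symmetric group and $A$ for the alternating group. What matters about them is
  that $A$ is perfect and lies in every non-trivial normal subgroup of $G$.

  A word takes values in $A$ only, or has an odd exponent sum in some variable. In the second case,
  setting all other variables to the identity turns it into an odd power map, which permutes the
  elements of any given $2$-power order; hence all of these are values. Together with invariance
  under automorphisms and the value at the trivial tuple this shows that verbal images have one of
  the two forms.

  Conversely, let $X$ be invariant, and let $e$ be an exponent, $0$ in the first case and the odd
  part of $|G|$ in the second, so that all $e$-th powers lie in $X$. For each $x$, let $\<phi>_x$ be
  the tuple that enumerates $G$ and then has $x$ as an additional last entry. A tuple is the same
  as a homomorphism from the free group to $G$. The tuples $\<phi>_x$ are surjective with pairwise
  incomparable kernels, and a tuple whose kernel is contained in that of $\<phi>_x$ is the image of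
  $\<phi>_x$ under an automorphism of $G$, by counting
  (\<open>ex_automorphism_if_kernel_le\<close>). For any other tuple $t$, the kernel of $t$ is mapped by
  $\<phi>_x$ onto a non-trivial normal subgroup, so onto one containing $A$. Since $A$ is perfect,
  commutators allow finitely many such conditions to be combined
  (\<open>perfect_subset_vanishing_values\<close>): any element of $A$ is the value at $\<phi>_x$ of a word that
  is trivial at all tuples not equivalent to $\<phi>_x$. A product of such words is a word $w$ with
  value $x^{-e} x$ at $\<phi>_x$ for each $x \<in> X$, and trivial at every tuple not equivalent to one
  of these. If $z$ is the variable of the last entry, then $z^e w$ has the value $x$ at $\<phi>_x$ and
  an $e$-th power at the tuples of the last kind, so its image is $X$
  (\<open>verbal_image_criterion\<close>). In both cases $x^{-e} x$ lies in $A$, as needed.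

  This construction works in every finite group $G$ with such a subgroup $A$, and is given in that
  generality.\<close>

section \<open>Words and their values\<close>

text \<open>Words need not be reduced here, so that they can be concatenated freely; see
  \<open>ex_reduced_word\<close> for the passage to free groups.\<close>

definition words :: "nat \<Rightarrow> (nat \<times> bool) list set" where
  "words k = {w. \<forall>(i, b) \<in> set w. i < k}"

definition inverse_word :: "(nat \<times> bool) list \<Rightarrow> (nat \<times> bool) list" where
  "inverse_word w = rev (map (\<lambda>(i, b). (i, \<not> b)) w)"

definition exponent_sum :: "nat \<Rightarrow> (nat \<times> bool) list \<Rightarrow> int" where
  "exponent_sum i w = (\<Sum>(j, b)\<leftarrow>w. if j = i then if b then 1 else -1 else 0)"

lemma Nil_in_words [simp]: "[] \<in> words k"
  and Cons_in_words [simp]: "(i, b) # w \<in> words k \<longleftrightarrow> i < k \<and> w \<in> words k"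
  and append_in_words [simp]: "u @ v \<in> words k \<longleftrightarrow> u \<in> words k \<and> v \<in> words k"
  and inverse_word_in_words [simp]: "w \<in> words k \<Longrightarrow> inverse_word w \<in> words k"
  and replicate_in_words [simp]: "i < k \<Longrightarrow> replicate e (i, b) \<in> words k"
  by (auto simp: words_def inverse_word_def)

lemma free_group_words_subset_words: "free_group_words k \<subseteq> words k"
  by (auto simp: free_group_words_def words_def)

lemma word_map_Nil [simp]: "word_map G [] f = \<one>\<^bsub>G\<^esub>"
  by (simp add: word_map_def)

lemma word_map_Cons [simp]:
  "word_map G ((i, b) # w) f =
    (if b then f i else inv\<^bsub>G\<^esub> (f i)) \<otimes>\<^bsub>G\<^esub> word_map G w f"
  by (simp add: word_map_def)

context group
begin

lemma word_map_closed [simp, intro]: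
  assumes "f \<in> {..<k} \<rightarrow> carrier G" "w \<in> words k"
  shows "word_map G w f \<in> carrier G"
  using assms(2)
proof (induction w)
  case (Cons l w)
  with assms(1) show ?case by (cases l) (auto simp: Pi_iff)
qed simp

lemma word_map_append [simp]:
  assumes "f \<in> {..<k} \<rightarrow> carrier G" "u \<in> words k" "v \<in> words k"
  shows "word_map G (u @ v) f = word_map G u f \<otimes> word_map G v f"
  using assms(2)
proof (induction u)
  case Nil
  with assms show ?case by (simp add: word_map_closed[of f k])
next
  case (Cons l u)
  obtain i b where l: "l = (i, b)" by (cases l)
  with Cons.prems assms(1) have "f i \<in> carrier G" by (auto simp: Pi_iff)
  with Cons l assms show ?case
    by (simp add: m_assoc word_map_closed[of f k])
qed

lemma word_map_inverse_word [simp]: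
  assumes "f \<in> {..<k} \<rightarrow> carrier G" "w \<in> words k"
  shows "word_map G (inverse_word w) f = inv (word_map G w f)"
  using assms(2)
proof (induction w)
  case Nil
  show ?case by (simp add: inverse_word_def)
next
  case (Cons l w)
  obtain i b where l: "l = (i, b)" by (cases l)
  with Cons.prems assms(1) have fi: "f i \<in> carrier G" by (auto simp: Pi_iff)
  have "inverse_word (l # w) = inverse_word w @ [(i, \<not> b)]"
    by (simp add: inverse_word_def l)
  moreover have "word_map G (inverse_word w @ [(i, \<not> b)]) f
      = word_map G (inverse_word w) f \<otimes> word_map G [(i, \<not> b)] f"
    using Cons.prems l assms(1) by (intro word_map_append[of f k]) auto
  ultimately show ?case
    using Cons l assms(1) fi by (simp add: inv_mult_group word_map_closed[of f k])
qed

lemma word_map_replicate: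
  assumes "f i \<in> carrier G"
  shows "word_map G (replicate e (i, True)) f = f i [^] (e::nat)"
proof (induction e)
  case (Suc e)
  then have "word_map G (replicate (Suc e) (i, True)) f = f i \<otimes> f i [^] e" by simp
  also have "\<dots> = f i [^] Suc e" by (rule nat_pow_Suc2[OF assms, symmetric])
  finally show ?case .
qed simp

lemma word_map_hom:
  assumes "\<alpha> \<in> hom G G" "f \<in> {..<k} \<rightarrow> carrier G" "w \<in> words k"
  shows "word_map G w (\<lambda>i\<in>{..<k}. \<alpha> (f i)) = \<alpha> (word_map G w f)"
proof -
  interpret \<alpha>: group_hom G G \<alpha>
    using assms(1) by unfold_locales
  show ?thesis
    using assms(3)
  proof (induction w)
    case (Cons l w)
    obtain i b where l: "l = (i, b)" by (cases l)
    with Cons.prems assms(2) have "f i \<in> carrier G" by (auto simp: Pi_iff)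
    with Cons l show ?case by (simp add: word_map_closed[OF assms(2)])
  qed simp
qed

text \<open>A letter put in front of a reduced word either keeps it reduced or cancels its first letter, and
  neither step affects values. Hence verbal images may be computed with arbitrary words.\<close>

lemma ex_reduced_word:
  assumes "w \<in> words k"
  shows "\<exists>v \<in> free_group_words k. \<forall>f \<in> {..<k} \<rightarrow> carrier G. word_map G v f = word_map G w f"
  using assms
proof (induction w)
  case Nil
  show ?case by (intro bexI[of _ "[]"]) (auto simp: free_group_words_def)
next
  case (Cons l w)
  obtain i b where l: "l = (i, b)" by (cases l)
  with Cons obtain v where v: "v \<in> free_group_words k"
    and eq: "\<And>f. f \<in> {..<k} \<rightarrow> carrier G \<Longrightarrow> word_map G v f = word_map G w f"
    by auto
  have i: "i < k" using Cons.prems l by simp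
  show ?case
  proof (cases "\<exists>u. v = (i, \<not> b) # u")
    case True
    then obtain u where u: "v = (i, \<not> b) # u" by blast
    have ufree: "u \<in> free_group_words k"
      using v u by (cases u) (auto simp: free_group_words_def)
    have "word_map G u f = word_map G (l # w) f" if f: "f \<in> {..<k} \<rightarrow> carrier G" for f
    proof -
      have fi: "f i \<in> carrier G" using f i by auto
      have uc: "word_map G u f \<in> carrier G"
        using ufree f free_group_words_subset_words by blast
      have "word_map G (l # w) f = (if b then f i else inv (f i)) \<otimes> word_map G v f"
        using eq[OF f] l by simp
      also have "\<dots> = word_map G u f"
        using fi uc u by (simp add: m_assoc[symmetric])
      finally show ?thesis ..
    qed
    with ufree show ?thesis by blast
  next
    case False
    then have "(i, b) # v \<in> free_group_words k"
      using v i by (cases v) (auto simp: free_group_words_def)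
    moreover have "word_map G ((i, b) # v) f = word_map G (l # w) f"
      if "f \<in> {..<k} \<rightarrow> carrier G" for f
      using eq[OF that] l by simp
    ultimately show ?thesis by blast
  qed
qed

lemma verbal_imageI:
  assumes "w \<in> words k" "X = word_map G w ` ({..<k} \<rightarrow>\<^sub>E carrier G)"
  shows "verbal_image G X"
proof -
  obtain v where "v \<in> free_group_words k"
    and "\<forall>f \<in> {..<k} \<rightarrow> carrier G. word_map G v f = word_map G w f"
    using ex_reduced_word[OF assms(1)] by blast
  moreover from this have "X = word_image G k v"
    unfolding assms(2) word_image_def by (intro image_cong) (auto simp: PiE_def)
  ultimately show ?thesis
    unfolding verbal_image_def by blast
qed


section \<open>Separating tuples by words\<close>

text \<open>A tuple stands for the homomorphism from the free group that it defines; the relation is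
  containment of the kernel of $t$ in that of $f$.\<close>

definition kernel_le :: "nat \<Rightarrow> (nat \<Rightarrow> 'a) \<Rightarrow> (nat \<Rightarrow> 'a) \<Rightarrow> bool" where
  "kernel_le k t f \<longleftrightarrow> (\<forall>w \<in> words k. word_map G w t = \<one> \<longrightarrow> word_map G w f = \<one>)"

text \<open>The image under $f$ of the intersection of the kernels of all $t \<in> T$.\<close>

definition vanishing_values :: "nat \<Rightarrow> (nat \<Rightarrow> 'a) set \<Rightarrow> (nat \<Rightarrow> 'a) \<Rightarrow> 'a set" where
  "vanishing_values k T f =
    (\<lambda>w. word_map G w f) ` {w \<in> words k. \<forall>t \<in> T. word_map G w t = \<one>}"

text \<open>The homomorphism $f$ factors through the image of $t$. As $f$ is onto and the image of $t$ has at
  most $|G|$ elements, the induced map from this image is a bijection of $G$.\<close>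

lemma ex_automorphism_if_kernel_le:
  assumes fin: "finite (carrier G)" and t: "t \<in> {..<k} \<rightarrow> carrier G"
    and f: "f ` {..<k} = carrier G" and le: "kernel_le k t f"
  shows "\<exists>\<alpha> \<in> auto G. \<forall>w \<in> words k. \<alpha> (word_map G w t) = word_map G w f"
proof -
  have f': "f \<in> {..<k} \<rightarrow> carrier G" using f by auto
  define I where "I = (\<lambda>w. word_map G w t) ` words k"
  \<comment> \<open>The factor map: evaluate at \<open>f\<close> any word that has the given value at \<open>t\<close>.\<close>
  define \<beta> where "\<beta> x = word_map G (SOME w. w \<in> words k \<and> word_map G w t = x) f" for x
  have \<beta>: "\<beta> (word_map G w t) = word_map G w f" if w: "w \<in> words k" for w
  proof -
    define v where "v = (SOME v. v \<in> words k \<and> word_map G v t = word_map G w t)"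
    have v: "v \<in> words k" "word_map G v t = word_map G w t"
      unfolding v_def by (rule someI2[of _ w]; use w in auto)+
    have "word_map G (v @ inverse_word w) t = \<one>"
      using v w t by (simp add: word_map_closed[of t k] word_map_append[of t k]
        word_map_inverse_word[of t k])
    then have "word_map G (v @ inverse_word w) f = \<one>"
      using le v w unfolding kernel_le_def by simp
    then have "word_map G v f \<otimes> inv (word_map G w f) = \<one>"
      using v w f' by (simp add: word_map_append[of f k] word_map_inverse_word[of f k])
    then have "word_map G v f = word_map G w f"
      using v w f' by (metis inv_equality inv_inv inv_closed word_map_closed)
    then show ?thesis unfolding \<beta>_def v_def .
  qed
  have IG: "I \<subseteq> carrier G" using t unfolding I_def by auto
  have surj: "carrier G \<subseteq> \<beta> ` I"
  proof
    fix x assume "x \<in> carrier G"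
    then obtain i where i: "i < k" "x = f i" using f by auto
    then have "x = \<beta> (word_map G [(i, True)] t)"
      using \<beta>[of "[(i, True)]"] \<open>x \<in> carrier G\<close> by simp
    moreover have "word_map G [(i, True)] t \<in> I"
      unfolding I_def using i by (intro imageI) simp
    ultimately show "x \<in> \<beta> ` I" by (rule image_eqI)
  qed
  have finI: "finite I" using IG fin finite_subset by blast
  have "card (carrier G) \<le> card I"
    using surj_card_le[OF finI surj] .
  then have I: "I = carrier G"
    using card_seteq[OF fin IG] by simp
  have img: "\<beta> ` carrier G = carrier G"
  proof
    show "\<beta> ` carrier G \<subseteq> carrier G"
    proof
      fix y assume "y \<in> \<beta> ` carrier G"
      then obtain w where "w \<in> words k" "y = \<beta> (word_map G w t)"
        unfolding I[symmetric] I_def by blast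
      then show "y \<in> carrier G" using \<beta> f' by auto
    qed
  qed (use surj I in simp)
  then have inj: "inj_on \<beta> (carrier G)"
    using fin by (simp add: eq_card_imp_inj_on)
  have hom: "\<beta> (x \<otimes> y) = \<beta> x \<otimes> \<beta> y" if xy: "x \<in> carrier G" "y \<in> carrier G" for x y
  proof -
    obtain u v where uv: "u \<in> words k" "v \<in> words k"
      and x: "x = word_map G u t" and y: "y = word_map G v t"
      using xy unfolding I[symmetric] I_def by auto
    have "\<beta> (x \<otimes> y) = word_map G (u @ v) f"
      using \<beta>[of "u @ v"] uv t by (simp add: x y word_map_append[of t k])
    then show ?thesis
      using \<beta> uv f' by (simp add: x y word_map_append[of f k])
  qed
  define \<alpha> where "\<alpha> = restrict \<beta> (carrier G)"
  have "\<alpha> \<in> auto G"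
    unfolding auto_def Bij_def hom_def \<alpha>_def using img inj hom
    by (auto simp: bij_betw_def inj_on_def image_iff)
  moreover have "\<alpha> (word_map G w t) = word_map G w f" if "w \<in> words k" for w
    using that \<beta> t unfolding \<alpha>_def by (simp add: word_map_closed[of t k])
  ultimately show ?thesis by blast
qed

lemma vanishing_values_subgroup:
  assumes f: "f \<in> {..<k} \<rightarrow> carrier G" and T: "T \<subseteq> {..<k} \<rightarrow> carrier G"
  shows "subgroup (vanishing_values k T f) G"
proof (rule subgroupI)
  show "vanishing_values k T f \<subseteq> carrier G"
    using f unfolding vanishing_values_def by auto
  have "[] \<in> {w \<in> words k. \<forall>t \<in> T. word_map G w t = \<one>}" by simp
  then show "vanishing_values k T f \<noteq> {}"
    unfolding vanishing_values_def by blast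
next
  fix a assume "a \<in> vanishing_values k T f"
  then obtain u where u: "u \<in> words k" "\<forall>t\<in>T. word_map G u t = \<one>" "a = word_map G u f"
    unfolding vanishing_values_def by blast
  have "\<forall>t\<in>T. word_map G (inverse_word u) t = \<one>"
    using u T by (auto simp: word_map_inverse_word[of _ k] subset_iff)
  then show "inv a \<in> vanishing_values k T f"
    unfolding vanishing_values_def
    by (intro image_eqI[of _ _ "inverse_word u"]) (use u f in \<open>auto simp: word_map_inverse_word[of f k]\<close>)
next
  fix a b assume "a \<in> vanishing_values k T f" "b \<in> vanishing_values k T f"
  then obtain u v where u: "u \<in> words k" "\<forall>t\<in>T. word_map G u t = \<one>" "a = word_map G u f"
    and v: "v \<in> words k" "\<forall>t\<in>T. word_map G v t = \<one>" "b = word_map G v f"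
    unfolding vanishing_values_def by blast
  have "\<forall>t\<in>T. word_map G (u @ v) t = \<one>"
    using u v T by (auto simp: word_map_append[of _ k] subset_iff)
  then show "a \<otimes> b \<in> vanishing_values k T f"
    unfolding vanishing_values_def
    by (intro image_eqI[of _ _ "u @ v"]) (use u v f in \<open>auto simp: word_map_append[of f k]\<close>)
qed

lemma vanishing_values_normal:
  assumes f: "f ` {..<k} = carrier G" and T: "T \<subseteq> {..<k} \<rightarrow> carrier G"
  shows "vanishing_values k T f \<lhd> G"
proof -
  have f': "f \<in> {..<k} \<rightarrow> carrier G" using f by auto
  have "x \<otimes> a \<otimes> inv x \<in> vanishing_values k T f"
    if x: "x \<in> carrier G" and a: "a \<in> vanishing_values k T f" for x a
  proof -
    obtain u where u: "u \<in> words k" "\<And>t. t \<in> T \<Longrightarrow> word_map G u t = \<one>" "a = word_map G u f"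
      using a unfolding vanishing_values_def by blast
    obtain i where i: "i < k" "x = f i" using x f by auto
    let ?w = "(i, True) # u @ [(i, False)]"
    have "word_map G ?w t = \<one>" if "t \<in> T" for t
    proof -
      have t: "t \<in> {..<k} \<rightarrow> carrier G" using T that by blast
      then have "t i \<in> carrier G" using i by auto
      with t u(1) u(2)[OF that] i show ?thesis by (simp add: word_map_append[of t k])
    qed
    moreover have "x \<otimes> a \<otimes> inv x = word_map G ?w f"
      using x u i f' by (simp add: word_map_append[of f k] m_assoc word_map_closed[of f k])
    ultimately show ?thesis
      unfolding vanishing_values_def
      by (intro image_eqI[of _ _ ?w]) (use u i in auto)
  qed
  then show ?thesis
    using vanishing_values_subgroup[OF f' T] normal_inv_iff by blast
qed

text \<open>For normal subgroups $M$ and $N$ of the free group, the intersection of $M$ and $N$ contains all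
  commutators of elements of $M$ with elements of $N$. If $A$ is contained in the images of both $M$
  and $N$, then the image of the intersection contains the commutators of elements of $A$, and so
  $A$ itself, because $A$ is perfect. This allows the tuples in $T$ to be treated one at a time.\<close>

lemma perfect_subset_vanishing_values:
  assumes A: "A \<subseteq> carrier G" and perfect: "derived G A = A"
    and minimal: "\<And>N. N \<lhd> G \<Longrightarrow> N \<noteq> {\<one>} \<Longrightarrow> A \<subseteq> N"
    and f: "f ` {..<k} = carrier G"
    and "finite T" "T \<subseteq> {..<k} \<rightarrow> carrier G" "\<And>t. t \<in> T \<Longrightarrow> \<not> kernel_le k t f"
  shows "A \<subseteq> vanishing_values k T f"
  using assms(5-)
proof (induction T)
  case empty
  have "A \<subseteq> carrier G" by (fact A)
  also have "\<dots> \<subseteq> vanishing_values k {} f"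
  proof
    fix x assume "x \<in> carrier G"
    then obtain i where "i < k" "x = f i" using f by auto
    then show "x \<in> vanishing_values k {} f"
      using \<open>x \<in> carrier G\<close> unfolding vanishing_values_def
      by (intro image_eqI[of _ _ "[(i, True)]"]) auto
  qed
  finally show ?case .
next
  case (insert t T)
  have f': "f \<in> {..<k} \<rightarrow> carrier G" using f by auto
  have t: "t \<in> {..<k} \<rightarrow> carrier G" and T: "T \<subseteq> {..<k} \<rightarrow> carrier G"
    using insert.prems by auto
  have AT: "A \<subseteq> vanishing_values k T f"
    using insert by blast
  obtain w where "w \<in> words k" "word_map G w t = \<one>" "word_map G w f \<noteq> \<one>"
    using insert.prems(2)[of t] unfolding kernel_le_def by auto
  then have "vanishing_values k {t} f \<noteq> {\<one>}"
    unfolding vanishing_values_def by auto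
  moreover have "vanishing_values k {t} f \<lhd> G"
    using t by (intro vanishing_values_normal[OF f]) auto
  ultimately have At: "A \<subseteq> vanishing_values k {t} f"
    using minimal by blast
  let ?V = "vanishing_values k (insert t T) f"
  have "derived_set G A \<subseteq> ?V"
  proof clarify
    fix a b assume "a \<in> A" "b \<in> A"
    with AT At obtain u v where u: "u \<in> words k" "\<And>s. s \<in> T \<Longrightarrow> word_map G u s = \<one>"
        "a = word_map G u f"
      and v: "v \<in> words k" "word_map G v t = \<one>" "b = word_map G v f"
      unfolding vanishing_values_def by blast
    let ?w = "u @ v @ inverse_word u @ inverse_word v"
    have val: "word_map G ?w s = word_map G u s \<otimes> word_map G v s \<otimes> inv (word_map G u s)
        \<otimes> inv (word_map G v s)" if "s \<in> {..<k} \<rightarrow> carrier G" for s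
      using that u v by (simp add: word_map_append[of s k] word_map_inverse_word[of s k]
          word_map_closed[of s k] m_assoc)
    have "word_map G ?w s = \<one>" if "s \<in> insert t T" for s
    proof -
      have s: "s \<in> {..<k} \<rightarrow> carrier G" using that t T by blast
      from that consider "word_map G v s = \<one>" | "word_map G u s = \<one>"
        using u v by blast
      then show ?thesis
        by cases (use s u v val[OF s] in \<open>simp_all add: word_map_closed[of s k]\<close>)
    qed
    then show "a \<otimes> b \<otimes> inv a \<otimes> inv b \<in> ?V"
      unfolding vanishing_values_def
      by (intro image_eqI[of _ _ ?w]) (use u v val[OF f'] in auto)
  qed
  then have "derived G A \<subseteq> ?V"
    unfolding derived_def
    using generate_subgroup_incl vanishing_values_subgroup[OF f' insert.prems(1)] by blast
  then show ?case using perfect by simp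
qed


section \<open>A criterion for verbal images\<close>

text \<open>For each $y$, take a word with value $c_y$ at $\<phi>_y$ that is trivial at every tuple whose kernel
  is not contained in that of $\<phi>_y$. As the kernels are incomparable, these words do not interfere
  with each other, and their product is as required.\<close>

lemma ex_word_with_prescribed_values:
  assumes fin: "finite (carrier G)" and A: "A \<subseteq> carrier G" and perfect: "derived G A = A"
    and minimal: "\<And>N. N \<lhd> G \<Longrightarrow> N \<noteq> {\<one>} \<Longrightarrow> A \<subseteq> N"
    and "finite Y"
    and \<phi>: "\<And>y. y \<in> Y \<Longrightarrow> \<phi> y \<in> {..<k} \<rightarrow>\<^sub>E carrier G"
      "\<And>y. y \<in> Y \<Longrightarrow> \<phi> y ` {..<k} = carrier G"
    and indep: "\<And>y z. y \<in> Y \<Longrightarrow> z \<in> Y \<Longrightarrow> y \<noteq> z \<Longrightarrow> \<not> kernel_le k (\<phi> y) (\<phi> z)"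
    and c: "\<And>y. y \<in> Y \<Longrightarrow> c y \<in> A"
  shows "\<exists>w \<in> words k. (\<forall>y \<in> Y. word_map G w (\<phi> y) = c y) \<and>
    (\<forall>t \<in> {..<k} \<rightarrow>\<^sub>E carrier G. (\<forall>y \<in> Y. \<not> kernel_le k t (\<phi> y)) \<longrightarrow> word_map G w t = \<one>)"
  using assms(5-)
proof (induction Y)
  case empty
  show ?case by (intro bexI[of _ "[]"]) auto
next
  case (insert z Y)
  let ?P = "{..<k} \<rightarrow>\<^sub>E carrier G"
  obtain w where w: "w \<in> words k" "\<And>y. y \<in> Y \<Longrightarrow> word_map G w (\<phi> y) = c y"
    "\<And>t. t \<in> ?P \<Longrightarrow> \<forall>y\<in>Y. \<not> kernel_le k t (\<phi> y) \<Longrightarrow> word_map G w t = \<one>"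
  proof -
    have "\<exists>w\<in>words k. (\<forall>y\<in>Y. word_map G w (\<phi> y) = c y) \<and>
        (\<forall>t\<in>?P. (\<forall>y\<in>Y. \<not> kernel_le k t (\<phi> y)) \<longrightarrow> word_map G w t = \<one>)"
    proof (rule insert.IH)
      fix y z assume "y \<in> Y" "z \<in> Y" "y \<noteq> z"
      then show "\<not> kernel_le k (\<phi> y) (\<phi> z)" by (intro insert.prems(3)) auto
    qed (simp_all add: insert.prems(1,2,4))
    with that show thesis by blast
  qed
  define T where "T = {t \<in> ?P. \<not> kernel_le k t (\<phi> z)}"
  have "finite ?P" using fin by (intro finite_PiE) auto
  then have "finite T" by (rule finite_subset[rotated]) (auto simp: T_def)
  then have T: "finite T" "T \<subseteq> {..<k} \<rightarrow> carrier G" "\<And>t. t \<in> T \<Longrightarrow> \<not> kernel_le k t (\<phi> z)"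
    by (auto simp: T_def PiE_iff)
  have "A \<subseteq> vanishing_values k T (\<phi> z)"
  proof (rule perfect_subset_vanishing_values[OF A perfect _ _ T])
    show "A \<subseteq> N" if "N \<lhd> G" "N \<noteq> {\<one>}" for N using minimal that .
    show "\<phi> z ` {..<k} = carrier G" using insert.prems(2) by simp
  qed
  then obtain v where v: "v \<in> words k" "\<And>t. t \<in> T \<Longrightarrow> word_map G v t = \<one>"
    "word_map G v (\<phi> z) = c z"
    using insert.prems(4)[of z] unfolding vanishing_values_def by force
  have app: "word_map G (w @ v) t = word_map G w t \<otimes> word_map G v t" if "t \<in> ?P" for t
    using that w(1) v(1) by (intro word_map_append[of t k]) (auto simp: PiE_def)
  have cl: "c y \<in> carrier G" if "y \<in> insert z Y" for y
    using insert.prems(4)[OF that] A by blast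
  show ?case
  proof (intro bexI[of _ "w @ v"] conjI ballI impI)
    fix y assume y: "y \<in> insert z Y"
    show "word_map G (w @ v) (\<phi> y) = c y"
    proof (cases "y = z")
      case True
      have "word_map G w (\<phi> z) = \<one>"
      proof (intro w(3) ballI)
        show "\<phi> z \<in> ?P" using insert.prems(1) by blast
        fix x assume "x \<in> Y"
        with insert.hyps(2) show "\<not> kernel_le k (\<phi> z) (\<phi> x)"
          by (intro insert.prems(3)) auto
      qed
      then show ?thesis using True v app[OF insert.prems(1)[OF y]] cl[OF y] by simp
    next
      case False
      then have "\<phi> y \<in> T"
        unfolding T_def using insert.prems(1,3) y by blast
      then show ?thesis
        using False y v w app[OF insert.prems(1)[OF y]] cl[OF y] by simp
    qed
  next
    fix t assume "t \<in> ?P" "\<forall>y\<in>insert z Y. \<not> kernel_le k t (\<phi> y)"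
    then show "word_map G (w @ v) t = \<one>"
      using w(3) v(2) app unfolding T_def by simp
  qed (use w v in simp)
qed

text \<open>The power $z^e$ of the last variable $z$ ensures that the word still takes values in $X$ where the
  correcting factor is trivial. At $\<phi>_x$ this power has the value $x^e$, which lies in the same
  coset of $A$ as $x$. This is how values outside of $A$ are reached, although the correcting factor
  has its values in $A$ at these tuples.\<close>

theorem verbal_image_criterion:
  assumes fin: "finite (carrier G)" and A: "A \<subseteq> carrier G" and perfect: "derived G A = A"
    and minimal: "\<And>N. N \<lhd> G \<Longrightarrow> N \<noteq> {\<one>} \<Longrightarrow> A \<subseteq> N"
    and X: "aut_invariant G X"
    and powers: "\<And>g. g \<in> carrier G \<Longrightarrow> g [^] (e::nat) \<in> X"
    and quotients: "\<And>x. x \<in> X \<Longrightarrow> inv (x [^] e) \<otimes> x \<in> A"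
  shows "verbal_image G X"
proof -
  have XG: "X \<subseteq> carrier G" using X by (simp add: aut_invariant_def)
  obtain h where h: "bij_betw h {0..<card (carrier G)} (carrier G)"
    using ex_bij_betw_nat_finite[OF fin] by blast
  define m where "m = card (carrier G)"
  define k where "k = Suc m"
  have h: "h ` {..<m} = carrier G"
    using h by (simp add: bij_betw_def m_def lessThan_atLeast0)
  let ?P = "{..<k} \<rightarrow>\<^sub>E carrier G"
  define \<phi> where "\<phi> x = (\<lambda>i\<in>{..<k}. if i < m then h i else x)" for x
  have \<phi>m [simp]: "\<phi> x m = x" for x by (simp add: \<phi>_def k_def)
  have \<phi>P: "\<phi> x \<in> ?P" if "x \<in> carrier G" for x
  proof -
    have "h i \<in> carrier G" if "i < m" for i using h that by blast
    with that show ?thesis unfolding \<phi>_def by auto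
  qed
  have \<phi>_surj: "\<phi> x ` {..<k} = carrier G" if "x \<in> carrier G" for x
  proof
    show "\<phi> x ` {..<k} \<subseteq> carrier G" using \<phi>P[OF that] by auto
    have "h i = \<phi> x i" if "i < m" for i using that by (simp add: \<phi>_def k_def)
    then show "carrier G \<subseteq> \<phi> x ` {..<k}"
      unfolding h[symmetric] by (auto simp: k_def)
  qed
  have indep: "\<not> kernel_le k (\<phi> y) (\<phi> z)"
    if y: "y \<in> carrier G" and z: "z \<in> carrier G" and "y \<noteq> z" for y z
  proof
    assume le: "kernel_le k (\<phi> y) (\<phi> z)"
    \<comment> \<open>The last entry of \<open>\<phi> y\<close> repeats the entry \<open>y\<close> of the enumeration; this relation fails
      for \<open>\<phi> z\<close>.\<close>
    obtain i where i: "i < m" "h i = y" using h y by (metis imageE lessThan_iff)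
    have \<phi>i: "\<phi> x i = y" for x using i by (simp add: \<phi>_def k_def)
    have "word_map G [(m, True), (i, False)] (\<phi> y) = \<one>"
      using y \<phi>i by simp
    then have "word_map G [(m, True), (i, False)] (\<phi> z) = \<one>"
      using le i unfolding kernel_le_def by (simp add: k_def del: word_map_Cons)
    then have "z \<otimes> inv y = \<one>" using y z \<phi>i by simp
    with y z have "z = y" by (metis inv_closed inv_equality inv_inv)
    with \<open>y \<noteq> z\<close> show False by simp
  qed
  have finX: "finite X" using XG fin finite_subset by blast
  have "\<exists>w \<in> words k. (\<forall>x \<in> X. word_map G w (\<phi> x) = inv (x [^] e) \<otimes> x) \<and>
      (\<forall>t \<in> ?P. (\<forall>x \<in> X. \<not> kernel_le k t (\<phi> x)) \<longrightarrow> word_map G w t = \<one>)"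
  proof (rule ex_word_with_prescribed_values[OF fin A perfect _ finX])
    show "A \<subseteq> N" if "N \<lhd> G" "N \<noteq> {\<one>}" for N using minimal that .
    show "\<phi> x \<in> ?P" if "x \<in> X" for x using \<phi>P that XG by blast
    show "\<phi> x ` {..<k} = carrier G" if "x \<in> X" for x using \<phi>_surj that XG by blast
    show "\<not> kernel_le k (\<phi> x) (\<phi> y)" if "x \<in> X" "y \<in> X" "x \<noteq> y" for x y
      using indep that XG by blast
    show "inv (x [^] e) \<otimes> x \<in> A" if "x \<in> X" for x using quotients that .
  qed
  then obtain w where w: "w \<in> words k"
    and w\<phi>: "\<And>x. x \<in> X \<Longrightarrow> word_map G w (\<phi> x) = inv (x [^] e) \<otimes> x"
    and w1: "\<And>t. t \<in> ?P \<Longrightarrow> \<forall>x\<in>X. \<not> kernel_le k t (\<phi> x) \<Longrightarrow> word_map G w t = \<one>"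
    by blast
  define W where "W = replicate e (m, True) @ w"
  have W: "W \<in> words k" using w by (simp add: W_def k_def)
  have val: "word_map G W t = t m [^] e \<otimes> word_map G w t" if "t \<in> ?P" for t
  proof -
    have t: "t \<in> {..<k} \<rightarrow> carrier G" "t m \<in> carrier G" using that by (auto simp: PiE_def k_def)
    then show ?thesis
      unfolding W_def using w by (simp add: word_map_append[of t k] word_map_replicate k_def)
  qed
  have W\<phi>: "word_map G W (\<phi> x) = x" if x: "x \<in> X" for x
  proof -
    have xG: "x \<in> carrier G" using x XG by blast
    show ?thesis using val[OF \<phi>P[OF xG]] w\<phi>[OF x] xG by (simp add: m_assoc[symmetric])
  qed
  have "X = word_map G W ` ?P"
  proof (intro equalityI subsetI)
    fix x assume x: "x \<in> X"
    then show "x \<in> word_map G W ` ?P"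
      using W\<phi>[OF x] \<phi>P XG by (metis image_eqI subsetD)
  next
    fix v assume "v \<in> word_map G W ` ?P"
    then obtain t where t: "t \<in> ?P" "v = word_map G W t" by blast
    have t': "t \<in> {..<k} \<rightarrow> carrier G" using t by (simp add: PiE_def)
    show "v \<in> X"
    proof (cases "\<exists>x\<in>X. kernel_le k t (\<phi> x)")
      case True
      then obtain x where x: "x \<in> X" "kernel_le k t (\<phi> x)" by blast
      obtain \<alpha> where \<alpha>: "\<alpha> \<in> auto G" "\<alpha> (word_map G W t) = word_map G W (\<phi> x)"
        using ex_automorphism_if_kernel_le[OF fin t' \<phi>_surj x(2)] x(1) XG W by blast
      then have "\<alpha> v \<in> \<alpha> ` X"
        using X x W\<phi> t unfolding aut_invariant_def by simp
      moreover have "inj_on \<alpha> (carrier G)"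
        using \<alpha>(1) by (simp add: auto_def Bij_def bij_betw_def)
      moreover have "v \<in> carrier G" using t' W t(2) by auto
      ultimately show ?thesis using XG by (meson inj_on_image_mem_iff)
    next
      case False
      have "t m \<in> carrier G" using t' by (auto simp: k_def)
      with False t show ?thesis using val[OF t(1)] w1[OF t(1)] powers by simp
    qed
  qed
  with W show ?thesis by (intro verbal_imageI)
qed


section \<open>Constraints on verbal images\<close>

lemma verbal_image_one:
  assumes "verbal_image G X"
  shows "\<one> \<in> X"
proof -
  obtain k w where w: "w \<in> free_group_words k" and X: "X = word_image G k w"
    using assms unfolding verbal_image_def by blast
  let ?f = "\<lambda>i\<in>{..<k}. \<one>"
  have "w \<in> words k" using w free_group_words_subset_words by blast
  then have "word_map G w ?f = \<one>"
    by (induction w) auto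
  then show ?thesis
    unfolding X word_image_def by (intro image_eqI[of _ _ ?f]) auto
qed

lemma verbal_image_aut_invariant:
  assumes "verbal_image G X"
  shows "aut_invariant G X"
proof -
  obtain k w where w: "w \<in> free_group_words k" and X: "X = word_image G k w"
    using assms unfolding verbal_image_def by blast
  have w: "w \<in> words k" using w free_group_words_subset_words by blast
  let ?P = "{..<k} \<rightarrow>\<^sub>E carrier G"
  have X: "X = word_map G w ` ?P" using X by (simp add: word_image_def)
  have "\<alpha> ` X = X" if \<alpha>: "\<alpha> \<in> auto G" for \<alpha>
  proof -
    have hom: "\<alpha> \<in> hom G G" and bij: "bij_betw \<alpha> (carrier G) (carrier G)"
      using \<alpha> by (auto simp: auto_def Bij_def)
    let ?c = "\<lambda>f. \<lambda>i\<in>{..<k}. \<alpha> (f i)"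
    have comm: "\<alpha> (word_map G w f) = word_map G w (?c f)" if "f \<in> ?P" for f
      using word_map_hom[OF hom _ w] that by (simp add: PiE_def)
    have "?c ` ?P = ?P"
    proof (intro equalityI subsetI)
      fix f assume f: "f \<in> ?P"
      let ?g = "\<lambda>i\<in>{..<k}. inv_into (carrier G) \<alpha> (f i)"
      have "?g \<in> ?P"
        using f bij by (auto simp: bij_betw_def intro!: inv_into_into)
      moreover have "f = ?c ?g"
        using f bij by (auto simp: fun_eq_iff bij_betw_inv_into_right PiE_iff extensional_def)
      ultimately show "f \<in> ?c ` ?P" by blast
    next
      fix g assume "g \<in> ?c ` ?P"
      then show "g \<in> ?P" using bij by (auto simp: bij_betw_def intro!: bij_betw_apply[OF bij])
    qed
    then show ?thesis
      unfolding X image_image using comm by (simp add: image_image[of "word_map G w" ?c, symmetric])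
  qed
  moreover have "X \<subseteq> carrier G" using w unfolding X by (auto simp: PiE_def)
  ultimately show ?thesis by (simp add: aut_invariant_def)
qed

lemma word_map_one_variable:
  assumes "g \<in> carrier G" "w \<in> words k"
  shows "word_map G w (\<lambda>j\<in>{..<k}. if j = i then g else \<one>) = g [^] exponent_sum i w"
  using assms(2)
proof (induction w)
  case Nil
  show ?case by (simp add: exponent_sum_def)
next
  case (Cons l w)
  obtain j b where "l = (j, b)" by (cases l)
  with Cons assms(1) show ?case
    by (auto simp: exponent_sum_def int_pow_mult int_pow_diff int_pow_neg)
qed

text \<open>On the cyclic group generated by $g$, raising to a power coprime to the order is invertible.\<close>

lemma mem_word_image_if_coprime_exponent_sum:
  assumes g: "g \<in> carrier G" and w: "w \<in> words k" and "i < k"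
    and "coprime (exponent_sum i w) (int (ord g))"
  shows "g \<in> word_map G w ` ({..<k} \<rightarrow>\<^sub>E carrier G)"
proof -
  let ?z = "exponent_sum i w"
  obtain u v where uv: "u * ?z + v * int (ord g) = 1"
    using assms(4) by (metis bezout_int coprime_imp_gcd_eq_1)
  define f where "f = (\<lambda>j\<in>{..<k}. if j = i then g [^] u else \<one>)"
  have "word_map G w f = (g [^] u) [^] ?z"
    unfolding f_def using word_map_one_variable[of "g [^] u" w k i] g w by simp
  also have "\<dots> = g [^] (u * ?z)"
    using g by (simp add: int_pow_pow)
  also have "\<dots> = g [^] (1::int)"
  proof -
    have "1 - u * ?z = v * int (ord g)" using uv by simp
    then show ?thesis using g by (subst int_pow_eq) auto
  qed
  finally have "g = word_map G w f" using g by simp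
  moreover have "f \<in> {..<k} \<rightarrow>\<^sub>E carrier G" using g by (auto simp: f_def)
  ultimately show ?thesis by blast
qed

lemma aut_invariant_Un:
  assumes "aut_invariant G B" "aut_invariant G C"
  shows "aut_invariant G (B \<union> C)"
  using assms by (simp add: aut_invariant_def image_Un)

lemma ord_automorphism:
  assumes "\<alpha> \<in> auto G" "g \<in> carrier G"
  shows "ord (\<alpha> g) = ord g"
proof -
  have hom: "\<alpha> \<in> hom G G" and bij: "bij_betw \<alpha> (carrier G) (carrier G)"
    using assms(1) by (auto simp: auto_def Bij_def)
  interpret \<alpha>: group_hom G G \<alpha> using hom by unfold_locales
  have "\<alpha> g [^] n = \<one> \<longleftrightarrow> g [^] n = \<one>" for n :: nat
  proof -
    have "\<alpha> g [^] n = \<one> \<longleftrightarrow> \<alpha> (g [^] n) = \<alpha> \<one>"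
      using assms(2) by (simp add: \<alpha>.hom_nat_pow)
    also have "\<dots> \<longleftrightarrow> g [^] n = \<one>"
      using bij assms(2) by (intro inj_on_eq_iff[of \<alpha> "carrier G"]) (auto simp: bij_betw_def)
    finally show ?thesis .
  qed
  then show ?thesis
    using assms(2) by (subst ord_unique) (auto simp: pow_eq_id)
qed

lemma two_power_order_elements_aut_invariant:
  "aut_invariant G (two_power_order_elements G)"
proof -
  have "\<alpha> ` two_power_order_elements G = two_power_order_elements G" if \<alpha>: "\<alpha> \<in> auto G" for \<alpha>
  proof -
    let ?C = "two_power_order_elements G"
    have img: "\<alpha> ` carrier G = carrier G"
      using \<alpha> by (simp add: auto_def Bij_def bij_betw_def)
    then have iff: "\<alpha> g \<in> ?C \<longleftrightarrow> g \<in> ?C" if "g \<in> carrier G" for g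
      using that ord_automorphism[OF \<alpha> that] unfolding two_power_order_elements_def by auto
    have sub: "?C \<subseteq> carrier G" by (auto simp: two_power_order_elements_def)
    show "\<alpha> ` ?C = ?C"
    proof (intro equalityI subsetI)
      fix y assume "y \<in> \<alpha> ` ?C"
      then show "y \<in> ?C" using iff sub by blast
    next
      fix y assume y: "y \<in> ?C"
      then obtain x where "x \<in> carrier G" "y = \<alpha> x" using img sub by blast
      then show "y \<in> \<alpha> ` ?C" using iff y by blast
    qed
  qed
  then show ?thesis by (auto simp: aut_invariant_def two_power_order_elements_def)
qed

lemma pow_odd_part_two_power_order:
  assumes "g \<in> carrier G" "order G = 2 ^ a * e"
  shows "g [^] e \<in> two_power_order_elements G"
proof -
  have "(g [^] e) [^] ((2::nat) ^ a) = \<one>"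
    using assms pow_order_eq_1[of g] by (simp add: nat_pow_pow mult.commute)
  then have "ord (g [^] e) dvd 2 ^ a"
    using assms by (simp add: pow_eq_id)
  then have "\<exists>m. ord (g [^] e) = 2 ^ m"
    using divides_primepow_nat[OF two_is_prime_nat] by blast
  then show ?thesis
    using assms by (simp add: two_power_order_elements_def)
qed

end


section \<open>Normal subgroups of the symmetric group\<close>

text \<open>The three points are moved to their targets one after the other by transpositions, none of which
  disturbs a point already placed.\<close>

lemma ex_permutation_three_points:
  assumes "distinct [a, b, c]" "distinct [a', b', c']"
    and "{a, b, c, a', b', c'} \<subseteq> S"
  shows "\<exists>p. p permutes S \<and> p a = a' \<and> p b = b' \<and> p c = c'"
proof -
  define p1 where "p1 = transpose a a'"
  define p2 where "p2 = transpose (p1 b) b' \<circ> p1"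
  define p3 where "p3 = transpose (p2 c) c' \<circ> p2"
  have p1: "p1 permutes S" "p1 a = a'"
    using assms by (auto simp: p1_def intro: permutes_swap_id)
  then have "p1 b \<in> S" "p1 b \<noteq> a'"
    using assms permutes_in_image[of p1 S b] permutes_inj[of p1 S] by (auto dest: injD)
  then have p2: "p2 permutes S" "p2 a = a'" "p2 b = b'"
    using assms p1 by (auto simp: p2_def intro!: permutes_compose permutes_swap_id)
  then have "p2 c \<in> S" "p2 c \<noteq> a'" "p2 c \<noteq> b'"
    using assms permutes_in_image[of p2 S c] permutes_inj[of p2 S] by (auto dest: injD)
  then have "p3 permutes S" "p3 a = a'" "p3 b = b'" "p3 c = c'"
    using assms p2 by (auto simp: p3_def intro!: permutes_compose permutes_swap_id)
  then show ?thesis by blast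
qed

lemma transpose_conj:
  assumes "bij p"
  shows "p \<circ> transpose a b \<circ> inv' p = transpose (p a) (p b)"
proof (cases "a = b")
  case True
  then show ?thesis using assms by (simp add: bij_is_surj surj_iff[symmetric])
next
  case False
  then show ?thesis using conjugation_of_cycle[of "[a, b]" p] assms by simp
qed

context
  fixes n :: nat and N :: "(nat \<Rightarrow> nat) set"
  assumes normal: "N \<lhd> sym_group n"
begin

lemma normal_sym_mult: "p \<in> N \<Longrightarrow> q \<in> N \<Longrightarrow> p \<circ> q \<in> N"
  using subgroup.m_closed[OF normal_imp_subgroup[OF normal]] by (simp add: sym_group_mult)

lemma normal_sym_permutes: "p \<in> N \<Longrightarrow> p permutes {1..n}"
  using subgroup.mem_carrier[OF normal_imp_subgroup[OF normal]] by (simp add: sym_group_carrier)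

lemma normal_sym_inv: "p \<in> N \<Longrightarrow> inv' p \<in> N"
  using subgroup.m_inv_closed[OF normal_imp_subgroup[OF normal]] normal_sym_permutes
  by (metis sym_group_carrier sym_group_inv_equality)

lemma normal_sym_conj:
  assumes "q permutes {1..n}" "p \<in> N"
  shows "q \<circ> p \<circ> inv' q \<in> N"
  using normal.inv_op_closed2[OF normal, of q p] assms
  by (simp add: sym_group_carrier sym_group_mult)

text \<open>All 3-cycles are conjugate in the symmetric group, and they generate the alternating group.\<close>

lemma normal_sym_three_cycles:
  assumes abc: "distinct [a, b, c]" "{a, b, c} \<subseteq> {1..n}" "cycle_of_list [a, b, c] \<in> N"
  shows "carrier (alt_group n) \<subseteq> N"
proof -
  have "three_cycles n \<subseteq> N"
  proof
    fix q assume "q \<in> three_cycles n"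
    then obtain cs where cs: "q = cycle_of_list cs" "cycle cs" "length cs = 3" "set cs \<subseteq> {1..n}"
      by auto
    then obtain a' b' c' where cs': "cs = [a', b', c']"
      using stupid_lemma by blast
    obtain p where p: "p permutes {1..n}" "map p [a, b, c] = cs"
      using ex_permutation_three_points[of a b c a' b' c' "{1..n}"] abc cs cs' by auto
    have "q = p \<circ> cycle_of_list [a, b, c] \<circ> inv' p"
      using conjugation_of_cycle[OF abc(1) permutes_bij[OF p(1)]] p(2) cs(1)
      by (simp del: cycle_of_list.simps list.map)
    then show "q \<in> N" using normal_sym_conj[OF p(1) abc(3)] by simp
  qed
  then have "generate (sym_group n) (three_cycles n) \<subseteq> N"
    using group.generate_subgroup_incl[OF sym_group_is_group]
      normal_imp_subgroup[OF normal] by blast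
  moreover have "carrier (alt_group n) = generate (sym_group n) (three_cycles n)"
    using group.generate_consistent[OF sym_group_is_group three_cycles_incl alt_group_is_subgroup]
    by (subst alt_group_carrier_as_three_cycles) (simp add: alt_group_def)
  ultimately show ?thesis by simp
qed

text \<open>Let $g$ be an element of the normal subgroup that moves $a$, and let $b$ differ from $a$ and $g(a)$.
  The commutator of $g$ with the transposition $(a\ b)$ is $(g(a)\ g(b))(a\ b)$, a product of two
  different transpositions. If these overlap, it is a 3-cycle. If not,
  its product with a conjugate that replaces $b$ by a fifth point $e$ is a 3-cycle.\<close>

lemma normal_sym_contains_alt:
  assumes n: "n \<ge> 5" and "N \<noteq> {id}"
  shows "carrier (alt_group n) \<subseteq> N"
proof -
  have "id \<in> N"
    using subgroup.one_closed[OF normal_imp_subgroup[OF normal]] by (simp add: sym_group_one)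
  with assms(2) obtain g where g: "g \<in> N" "g \<noteq> id" by blast
  have gp: "g permutes {1..n}" using normal_sym_permutes[OF g(1)] .
  have ginj: "g x = g y \<longleftrightarrow> x = y" for x y
    using permutes_inj[OF gp] by (auto dest: injD)
  obtain a where a: "g a \<noteq> a" using g(2) by (auto simp: fun_eq_iff)
  have aS: "a \<in> {1..n}" using gp a by (meson permutes_not_in)
  have avoid: "\<exists>b \<in> {1..n}. b \<notin> F" if "finite F" "card F < 5" for F :: "nat set"
  proof (rule ccontr)
    assume "\<not> ?thesis"
    then have "{1..n} \<subseteq> F" by auto
    from card_mono[OF that(1) this] that(2) n show False by simp
  qed
  obtain b where b: "b \<in> {1..n}" "b \<noteq> a" "b \<noteq> g a"
    using avoid[of "{a, g a}"] a by auto
  define u v where "u = g a" and "v = g b"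
  have S: "a \<in> {1..n}" "b \<in> {1..n}" "u \<in> {1..n}" "v \<in> {1..n}"
    using aS b(1) permutes_in_image[OF gp] by (auto simp: u_def v_def)
  have ne: "a \<noteq> b" "u \<noteq> a" "u \<noteq> b" "u \<noteq> v"
    using a b ginj by (auto simp: u_def v_def)
  have tp: "transpose x y permutes {1..n}" if "x \<in> {1..n}" "y \<in> {1..n}" for x y
    using that by (rule permutes_swap_id)
  have comm: "transpose u v \<circ> transpose a b \<in> N"
  proof -
    have "transpose a b \<circ> inv' g \<circ> inv' (transpose a b) \<in> N"
      using normal_sym_conj[OF tp normal_sym_inv[OF g(1)]] S by blast
    then have "g \<circ> (transpose a b \<circ> inv' g \<circ> transpose a b) \<in> N"
      using normal_sym_mult[OF g(1)] by simp
    then show ?thesis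
      using transpose_conj[OF permutes_bij[OF gp], of a b] by (simp add: u_def v_def o_assoc)
  qed
  consider "v = a" | "v = b" | "v \<noteq> a" "v \<noteq> b" by blast
  then show ?thesis
  proof cases
    case 1
    then have "cycle_of_list [u, a, b] \<in> N" using comm by simp
    then show ?thesis using ne S by (intro normal_sym_three_cycles[of u a b]) auto
  next
    case 2
    then have "cycle_of_list [u, b, a] \<in> N" using comm by (simp add: transpose_commute)
    then show ?thesis using ne S by (intro normal_sym_three_cycles[of u b a]) auto
  next
    case 3
    have "card {a, b, u, v} < 5" by (simp add: card_insert_if)
    then obtain e where e: "e \<in> {1..n}" "e \<notin> {a, b, u, v}"
      using avoid[of "{a, b, u, v}"] by auto
    let ?d = "transpose u v \<circ> transpose a b"
    have d': "transpose b e \<circ> ?d \<circ> transpose b e = transpose u v \<circ> transpose a e"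
    proof -
      have "u \<noteq> e" "v \<noteq> e" "a \<noteq> e" using e by auto
      then have uv: "transpose b e \<circ> transpose u v \<circ> transpose b e = transpose u v"
        and ab: "transpose b e \<circ> transpose a b \<circ> transpose b e = transpose a e"
        using transpose_conj[of "transpose b e" u v] transpose_conj[of "transpose b e" a b] ne 3
        by simp_all
      have "transpose b e \<circ> ?d \<circ> transpose b e
          = (transpose b e \<circ> transpose u v \<circ> transpose b e)
            \<circ> (transpose b e \<circ> transpose a b \<circ> transpose b e)"
        by (simp add: fun_eq_iff)
      also have "\<dots> = transpose u v \<circ> transpose a e"
        unfolding uv ab ..
      finally show ?thesis .
    qed
    have "transpose b e \<circ> ?d \<circ> inv' (transpose b e) \<in> N"
      using normal_sym_conj[OF tp comm] S e by blast
    then have "?d \<circ> (transpose u v \<circ> transpose a e) \<in> N"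
      using normal_sym_mult[OF comm] d' by simp
    moreover have "?d \<circ> (transpose u v \<circ> transpose a e) = cycle_of_list [b, a, e]"
    proof
      fix x
      consider "x = a" | "x = b" | "x = e" | "x = u" | "x = v" | "x \<notin> {a, b, e, u, v}" by blast
      then show "(?d \<circ> (transpose u v \<circ> transpose a e)) x = cycle_of_list [b, a, e] x"
        using ne 3 e by cases (simp_all add: transpose_def)
    qed
    ultimately show ?thesis
      using ne S e by (intro normal_sym_three_cycles[of b a e]) auto
  qed
qed

end

lemma derived_sym_alt:
  assumes "n \<ge> 5"
  shows "derived (sym_group n) (carrier (alt_group n)) = carrier (alt_group n)"
  using derived_alt_group_const[OF assms]
    group.derived_consistent[OF sym_group_is_group subset_refl alt_group_is_subgroup[of n]]
  by (simp add: alt_group_def)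


section \<open>Signs of word values\<close>

text \<open>The sign has values in a commutative group of exponent two, so only the parities of the exponent
  sums matter.\<close>

lemma sign_word_map:
  assumes "f \<in> {..<k} \<rightarrow> carrier (sym_group n)" "w \<in> words k"
  shows "sign (word_map (sym_group n) w f)
    = (\<Prod>i<k. if odd (exponent_sum i w) then sign (f i) else 1)"
  using assms(2)
proof (induction w)
  case Nil
  show ?case by (simp add: exponent_sum_def sym_group_one)
next
  case (Cons l w)
  interpret S: group "sym_group n" by (rule sym_group_is_group)
  obtain j b where l: "l = (j, b)" by (cases l)
  with Cons.prems have j: "j < k" and w: "w \<in> words k" by auto
  have fj: "f j \<in> carrier (sym_group n)" using assms(1) j by auto
  let ?x = "if b then f j else inv\<^bsub>sym_group n\<^esub> (f j)"
  let ?y = "word_map (sym_group n) w f"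
  have perm: "permutation (f j)" "permutation ?x" "permutation ?y"
    using fj S.word_map_closed[OF assms(1) w] S.inv_closed[OF fj]
    by (auto intro: sym_group_carrier' simp del: sym_group_inv_equality)
  have x: "sign ?x = sign (f j)"
    using fj perm(1) by (auto simp: sign_inverse)
  have "sign (word_map (sym_group n) (l # w) f) = sign ?x * sign ?y"
    unfolding l word_map_Cons sym_group_mult using perm(2,3) by (rule sign_compose)
  also have "\<dots> = (\<Prod>i<k. if i = j then sign (f i) else 1)
      * (\<Prod>i<k. if odd (exponent_sum i w) then sign (f i) else 1)"
    unfolding x Cons.IH[OF w] using j by simp
  also have "\<dots> = (\<Prod>i<k. if odd (exponent_sum i (l # w)) then sign (f i) else 1)"
    unfolding prod.distrib[symmetric]
    by (intro prod.cong refl) (auto simp: exponent_sum_def l sign_def)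
  finally show ?case .
qed

lemma verbal_image_sym_group_odd:
  assumes "verbal_image (sym_group n) X" "\<not> X \<subseteq> carrier (alt_group n)"
  shows "two_power_order_elements (sym_group n) \<subseteq> X"
proof
  interpret S: group "sym_group n" by (rule sym_group_is_group)
  obtain k w where w: "w \<in> free_group_words k" and X: "X = word_image (sym_group n) k w"
    using assms unfolding verbal_image_def by blast
  have w: "w \<in> words k" using w free_group_words_subset_words by blast
  let ?P = "{..<k} \<rightarrow>\<^sub>E carrier (sym_group n)"
  have X: "X = word_map (sym_group n) w ` ?P" using X by (simp add: word_image_def)
  obtain f where f: "f \<in> ?P" "word_map (sym_group n) w f \<notin> carrier (alt_group n)"
    using assms(2) X by blast
  have f': "f \<in> {..<k} \<rightarrow> carrier (sym_group n)" using f(1) by (simp add: PiE_def)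
  have "\<exists>i<k. odd (exponent_sum i w)"
  proof (rule ccontr)
    assume "\<not> ?thesis"
    then have "sign (word_map (sym_group n) w f) = 1"
      using sign_word_map[OF f' w] by simp
    moreover have "word_map (sym_group n) w f \<in> carrier (sym_group n)"
      using f' w by (rule S.word_map_closed)
    ultimately show False
      using f(2) by (auto simp: sym_group_carrier alt_group_carrier sign_def split: if_splits)
  qed
  then obtain i where i: "i < k" "odd (exponent_sum i w)" by blast
  fix g assume "g \<in> two_power_order_elements (sym_group n)"
  then obtain m where g: "g \<in> carrier (sym_group n)" "S.ord g = 2 ^ m"
    unfolding two_power_order_elements_def by blast
  have "coprime (exponent_sum i w) (int (S.ord g))"
    using i(2) g(2) by simp
  then show "g \<in> X"
    unfolding X by (rule S.mem_word_image_if_coprime_exponent_sum[OF g(1) w i(1)])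
qed


section \<open>Verbal images of symmetric groups\<close>

lemma verbal_image_sym_group_criterion:
  assumes n: "n \<ge> 5" and X: "aut_invariant (sym_group n) X"
    and powers: "\<And>g. g \<in> carrier (sym_group n) \<Longrightarrow> g [^]\<^bsub>sym_group n\<^esub> (e::nat) \<in> X"
    and e: "odd e \<or> X \<subseteq> carrier (alt_group n)"
  shows "verbal_image (sym_group n) X"
proof -
  interpret S: group "sym_group n" by (rule sym_group_is_group)
  interpret A: subgroup "carrier (alt_group n)" "sym_group n" by (rule alt_group_is_subgroup)
  have XG: "X \<subseteq> carrier (sym_group n)" using X by (simp add: aut_invariant_def)
  show ?thesis
  proof (rule S.verbal_image_criterion[OF _ A.subset derived_sym_alt[OF n] _ X powers])
    show "finite (carrier (sym_group n))"
      by (rule card_ge_0_finite) (simp add: sym_group_card_carrier)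
    show "carrier (alt_group n) \<subseteq> N"
      if "N \<lhd> sym_group n" "N \<noteq> {\<one>\<^bsub>sym_group n\<^esub>}" for N
      using normal_sym_contains_alt[OF that(1) n] that(2) by (simp add: sym_group_one)
    fix x assume x: "x \<in> X"
    then have xG: "x \<in> carrier (sym_group n)" using XG by blast
    show "inv\<^bsub>sym_group n\<^esub> (x [^]\<^bsub>sym_group n\<^esub> e) \<otimes>\<^bsub>sym_group n\<^esub> x \<in> carrier (alt_group n)"
    proof (cases "x \<in> carrier (alt_group n)")
      case True
      have "x [^]\<^bsub>sym_group n\<^esub> e \<in> carrier (alt_group n)"
        using True by (induction e) simp_all
      then show ?thesis
        using True A.m_inv_closed by (simp del: sym_group_inv_equality)
    next
      case False
      with e x have "odd e" by blast
      then obtain d where d: "e = 2 * d + 1" by (elim oddE)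
      interpret sgn: group_hom "sym_group n" sign_img sign by (rule sign_group_hom)
      have "sign (x [^]\<^bsub>sym_group n\<^esub> i) = sign x ^ i" for i :: nat
        by (induction i) (use xG in \<open>simp_all add: sign_img_def\<close>)
      moreover have "sign x ^ e = sign x"
        by (simp add: d sign_def)
      ultimately have "sign (x [^]\<^bsub>sym_group n\<^esub> e) = sign x" by simp
      moreover have "permutation (x [^]\<^bsub>sym_group n\<^esub> e)" "permutation x"
        using xG by (auto intro!: sym_group_carrier'[of _ n])
      ultimately have "sign (inv\<^bsub>sym_group n\<^esub> (x [^]\<^bsub>sym_group n\<^esub> e) \<otimes>\<^bsub>sym_group n\<^esub> x) = 1"
        using xG by (simp add: sym_group_mult sign_compose permutation_inverse sign_inverse)
      moreover have "inv\<^bsub>sym_group n\<^esub> (x [^]\<^bsub>sym_group n\<^esub> e) \<otimes>\<^bsub>sym_group n\<^esub> x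
          \<in> carrier (sym_group n)"
        using xG by (simp del: sym_group_inv_equality)
      ultimately show ?thesis
        unfolding alt_group_carrier sym_group_carrier sign_def by (simp split: if_splits)
    qed
  qed
qed

theorem theoremA:
  fixes n :: nat and X :: "(nat \<Rightarrow> nat) set"
  assumes "n \<ge> 5"
  shows "verbal_image (sym_group n) X \<longleftrightarrow>
      (aut_invariant (sym_group n) X \<and> X \<subseteq> carrier (alt_group n) \<and> \<one>\<^bsub>sym_group n\<^esub> \<in> X) \<or>
      (\<exists>B. aut_invariant (sym_group n) B \<and> X = B \<union> two_power_order_elements (sym_group n))"
    (is "?V \<longleftrightarrow> ?even \<or> ?odd")
proof -
  interpret S: group "sym_group n" by (rule sym_group_is_group)
  show ?thesis
  proof
    assume V: ?V
    then have inv: "aut_invariant (sym_group n) X" by (rule S.verbal_image_aut_invariant)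
    show "?even \<or> ?odd"
    proof (cases "X \<subseteq> carrier (alt_group n)")
      case True
      with V inv S.verbal_image_one show ?thesis by blast
    next
      case False
      then have "X = X \<union> two_power_order_elements (sym_group n)"
        using verbal_image_sym_group_odd[OF V] by blast
      with inv show ?thesis by blast
    qed
  next
    assume "?even \<or> ?odd"
    then show ?V
    proof
      assume ?even
      \<comment> \<open>The zeroth power contributes only the identity.\<close>
      then show ?V
        by (intro verbal_image_sym_group_criterion[OF assms, where e = 0]) auto
    next
      assume ?odd
      then obtain B where B: "aut_invariant (sym_group n) B"
        and X: "X = B \<union> two_power_order_elements (sym_group n)" by blast
      have "order (sym_group n) \<noteq> 0" by (simp add: order_def sym_group_card_carrier)
      then obtain a e where e: "order (sym_group n) = 2 ^ a * e" "odd e"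
        using prime_power_canonical[OF two_is_prime_nat, of "order (sym_group n)"]
        by (auto simp: mult.commute)
      show ?V
      proof (rule verbal_image_sym_group_criterion[OF assms])
        show "aut_invariant (sym_group n) X"
          unfolding X by (rule S.aut_invariant_Un[OF B S.two_power_order_elements_aut_invariant])
        show "g [^]\<^bsub>sym_group n\<^esub> e \<in> X" if "g \<in> carrier (sym_group n)" for g
          using S.pow_odd_part_two_power_order[OF that e(1)] X by blast
      qed (use e in simp)
    qed
  qed
qed

end
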